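(* Let $S$ be a $C$-semigroup and let $(X,d)$ be a metric space whose topology is Polish, equipped with a continuous action of $S$. If the dynamical system $(S,X)$ is an $M$-system which is not minimal or not equicontinuous, then $(S,X)$ is sensitive.
   Context: A topological semigroup $S$ acts continuously on $X$ if there is a jointly continuous map $S\times X\to X$, $(s,x)\mapsto sx$, with $s_1(s_2x)=(s_1s_2)x$ for all $s_1,s_2\in S$, $x\in X$; then $(S,X)$ is called a dynamical system ($S$-system). $S$ is not assumed to have an identity element. A topological space is Polish if it admits a compatible separable complete metric. $C$-semigroup: a topological semigroup $S$ such that for every $s_0\in S$ the subset $S\setminus Ss_0$ is relatively compact, i.e. its closure in $S$ is compact. The orbit of $x$ is $Sx=\{sx: s\in S\}$. The system $(S,X)$ is minimal if $\overline{Sx}=X$ for every $x\in X$. A point $x\in X$ is almost periodic if the subsystem $\overline{Sx}$ (the restriction of the action to this closed $S$-invariant set) is minimal and compact. $(S,X)$ is topologically transitive (TT) if for every pair $U,V$ of nonempty open subsets of $X$ there is $s\in S$ with $U\cap sV\neq\varnothing$. $(S,X)$ is an $M$-system if it is topologically transitive and the set of almost periodic points is dense in $X$. A point $x_0\in X$ is an equicontinuity point if for every $\varepsilon>0$ there is $\delta>0$ such that $d(x_0,x)<\delta$ implies $d(sx_0,sx)<\varepsilon$ for every $s\in S$. $(S,X)$ is equicontinuous if every point of $X$ is an equicontinuity point. $(S,X)$ is sensitive if there exists $c>0$ such that for all $x\in X$ and all $\delta>0$ there are $y\in X$ with $d(x,y)<\delta$ and $s\in S$ with $d(sx,sy)>c$.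 *)

theory Defs
  imports "HOL-Analysis.Analysis"
begin

definition polish_topology :: "'a topology \<Rightarrow> bool" where
  "polish_topology T \<longleftrightarrow> completely_metrizable_space T \<and> separable_space T"

definition C_semigroup :: "'s::topological_semigroup_mult itself \<Rightarrow> bool" where
  "C_semigroup _ \<longleftrightarrow> (\<forall>s0::'s. compact (closure (UNIV - range (\<lambda>s. s * s0))))"

definition dynamical_system ::
  "('s::topological_semigroup_mult \<Rightarrow> 'x::topological_space \<Rightarrow> 'x) \<Rightarrow> bool" where
  "dynamical_system act \<longleftrightarrow>
     continuous_on UNIV (\<lambda>(s, x). act s x) \<and>
     (\<forall>s1 s2 x. act s1 (act s2 x) = act (s1 * s2) x)"

definition orbit :: "('s \<Rightarrow> 'x \<Rightarrow> 'x) \<Rightarrow> 'x \<Rightarrow> 'x set" where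
  "orbit act x = range (\<lambda>s. act s x)"

text \<open>Minimality of the restriction of the action to an invariant set \<open>Y\<close>; the orbit closures
  are taken in the subspace \<open>Y\<close>. The whole system is the case \<open>Y = UNIV\<close>.\<close>

definition minimal_system :: "('s \<Rightarrow> 'x::topological_space \<Rightarrow> 'x) \<Rightarrow> 'x set \<Rightarrow> bool" where
  "minimal_system act Y \<longleftrightarrow> (\<forall>x\<in>Y. top_of_set Y closure_of orbit act x = Y)"

text \<open>The semigroup need not have an identity, so \<open>x\<close> itself may lie outside the closure of its
  orbit.\<close>

definition almost_periodic :: "('s \<Rightarrow> 'x::topological_space \<Rightarrow> 'x) \<Rightarrow> 'x \<Rightarrow> bool" where
  "almost_periodic act x \<longleftrightarrow>
     minimal_system act (closure (orbit act x)) \<and> compact (closure (orbit act x))"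

definition topologically_transitive :: "('s \<Rightarrow> 'x::topological_space \<Rightarrow> 'x) \<Rightarrow> bool" where
  "topologically_transitive act \<longleftrightarrow>
     (\<forall>U V. open U \<and> U \<noteq> {} \<and> open V \<and> V \<noteq> {} \<longrightarrow> (\<exists>s. U \<inter> act s ` V \<noteq> {}))"

definition M_system :: "('s \<Rightarrow> 'x::topological_space \<Rightarrow> 'x) \<Rightarrow> bool" where
  "M_system act \<longleftrightarrow> topologically_transitive act \<and> closure {x. almost_periodic act x} = UNIV"

definition equicontinuity_point :: "('s \<Rightarrow> 'x::metric_space \<Rightarrow> 'x) \<Rightarrow> 'x \<Rightarrow> bool" where
  "equicontinuity_point act x0 \<longleftrightarrow>
     (\<forall>\<epsilon>>0. \<exists>\<delta>>0. \<forall>x. dist x0 x < \<delta> \<longrightarrow> (\<forall>s. dist (act s x0) (act s x) < \<epsilon>))"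

definition equicontinuous_system :: "('s \<Rightarrow> 'x::metric_space \<Rightarrow> 'x) \<Rightarrow> bool" where
  "equicontinuous_system act \<longleftrightarrow> (\<forall>x. equicontinuity_point act x)"

definition sensitive :: "('s \<Rightarrow> 'x::metric_space \<Rightarrow> 'x) \<Rightarrow> bool" where
  "sensitive act \<longleftrightarrow>
     (\<exists>c>0. \<forall>x. \<forall>\<delta>>0. \<exists>y s. dist x y < \<delta> \<and> dist (act s x) (act s y) > c)"

end

theory Submission
  imports Defs
begin

text \<open>Suppose the system is not sensitive. Then for every \<open>e > 0\<close> some nonempty open set \<open>U\<close> is
  \<open>e\<close>-stable: all of its translates \<open>sU\<close> have diameter at most \<open>e\<close>. It has to be shown that the
  system is both minimal and equicontinuous.

  Stability can be pulled back along the action (\<open>stable_set_pullback\<close>). If \<open>sv\<close> lies in an open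
  \<open>e\<close>-stable set \<open>U\<close>, then an element \<open>ts\<close> of \<open>Ss\<close> maps a neighbourhood of \<open>v\<close> into \<open>tU\<close>; the
  remaining elements lie in the compact closure of \<open>S - Ss\<close>, and a compact set of
  transformations is equicontinuous at every point. By transitivity some orbit leads from any given
  open set into \<open>U\<close>, so stable open sets occur inside every nonempty open set.

  Minimality: let \<open>V\<close> be open and \<open>y\<close> any point; an orbit point of \<open>y\<close> in \<open>V\<close> is wanted. Choose a
  stable \<open>U\<close> well inside \<open>V\<close> and an almost periodic \<open>p\<close> in \<open>U\<close>, with compact minimal orbit closure
  \<open>M\<close>. Some \<open>su\<close> with \<open>u\<close> in \<open>U\<close> returns to \<open>U\<close>, and \<open>sp\<close> stays close to \<open>su\<close>, so \<open>M\<close> has a point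
  near \<open>U\<close>. By minimality and compactness, finitely many elements of \<open>S\<close> suffice to bring every
  point of \<open>M\<close> near \<open>U\<close>. By transitivity \<open>y\<close> is approximated by some \<open>su\<close> with \<open>u\<close> in \<open>U\<close>, closely
  enough for these finitely many maps. One of them brings \<open>sp\<close> near \<open>U\<close>; by stability it brings
  \<open>su\<close>, and hence \<open>y\<close>, there too.

  Equicontinuity: now every orbit enters every stable open set, and pulling stability back makes
  every point an equicontinuity point.\<close>

definition stable_set :: "('s \<Rightarrow> 'x::metric_space \<Rightarrow> 'x) \<Rightarrow> real \<Rightarrow> 'x set \<Rightarrow> bool" where
  "stable_set act e U \<longleftrightarrow> (\<forall>u\<in>U. \<forall>v\<in>U. \<forall>s. dist (act s u) (act s v) \<le> e)"

lemma stable_setD: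
  "stable_set act e U \<Longrightarrow> u \<in> U \<Longrightarrow> v \<in> U \<Longrightarrow> dist (act s u) (act s v) \<le> e"
  by (simp add: stable_set_def)

lemma stable_set_subset:
  "stable_set act e U \<Longrightarrow> W \<subseteq> U \<Longrightarrow> stable_set act e W"
  by (auto simp: stable_set_def)

lemma exists_stable_open_set_if_not_sensitive:
  assumes "\<not> sensitive act" and "e > 0"
  obtains U where "open U" "U \<noteq> {}" "stable_set act e U"
proof -
  have "e / 2 > 0" using \<open>e > 0\<close> by simp
  with assms(1) obtain x \<delta> where \<delta>: "\<delta> > 0"
    and *: "\<And>y s. dist x y < \<delta> \<Longrightarrow> dist (act s x) (act s y) \<le> e / 2"
    unfolding sensitive_def by (meson not_less)
  have "dist (act s u) (act s v) \<le> e" if "u \<in> ball x \<delta>" "v \<in> ball x \<delta>" for s u v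
    using *[of u s] *[of v s] that dist_triangle3[of "act s u" "act s v" "act s x"] by simp
  with \<delta> show thesis
    by (intro that[of "ball x \<delta>"]) (auto simp: stable_set_def)
qed

lemma dynamical_system_continuous_on:
  assumes "dynamical_system act" "continuous_on A f" "continuous_on A g"
  shows "continuous_on A (\<lambda>z. act (f z) (g z))"
proof -
  have "continuous_on UNIV (\<lambda>(s, x). act s x)"
    using assms(1) by (simp add: dynamical_system_def)
  from continuous_on_compose2[OF this continuous_on_Pair[OF assms(2,3)]]
  show ?thesis by simp
qed

lemma dynamical_system_open_preimage:
  assumes "dynamical_system act" "open U"
  shows "open {x. act s x \<in> U}"
proof -
  have "continuous_on UNIV (act s)"
    using dynamical_system_continuous_on[OF assms(1), of UNIV "\<lambda>_. s" "\<lambda>x. x"] by simp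
  with assms(2) have "open (act s -` U)" by (simp add: open_vimage)
  then show ?thesis by (simp add: vimage_def)
qed

text \<open>Over a compact parameter set the neighbourhood in joint continuity can be chosen uniformly,
  by the tube lemma.\<close>

lemma compact_equicontinuous_at:
  fixes act :: "'s::topological_semigroup_mult \<Rightarrow> 'x::metric_space \<Rightarrow> 'x"
  assumes "dynamical_system act" "compact K" "e > 0"
  obtains W where "open W" "v \<in> W" "\<And>k w. k \<in> K \<Longrightarrow> w \<in> W \<Longrightarrow> dist (act k v) (act k w) < e"
proof -
  let ?D = "{z :: 'x \<times> 's. dist (act (snd z) v) (act (snd z) (fst z)) < e}"
  have "open ?D"
    by (intro open_Collect_less continuous_intros dynamical_system_continuous_on[OF assms(1)])
  moreover have "{v} \<times> K \<subseteq> ?D" using \<open>e > 0\<close> by auto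
  ultimately obtain W where "v \<in> W \<and> open W \<and> W \<times> K \<subseteq> ?D"
    by (rule exE[OF Elementary_Topology.tube_lemma[OF assms(2)]])
  then show thesis by (intro that[of W]) auto
qed

text \<open>This is where the condition on the semigroup enters: transformations that do not factor through
  \<open>s\<close>, and so escape the stability of \<open>U\<close>, lie in a compact set and are equicontinuous at \<open>v\<close>.\<close>

lemma stable_set_pullback:
  fixes act :: "'s::topological_semigroup_mult \<Rightarrow> 'x::metric_space \<Rightarrow> 'x"
  assumes "C_semigroup TYPE('s)" "dynamical_system act" "e > 0"
    and "open U" "stable_set act e U" "act s v \<in> U"
  obtains W where "open W" "v \<in> W" "stable_set act e W"
proof -
  let ?K = "closure (UNIV - range (\<lambda>t. t * s))"
  have "compact ?K" using assms(1) by (simp add: C_semigroup_def)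
  then obtain W where W: "open W" "v \<in> W"
    and near: "\<And>k w. k \<in> ?K \<Longrightarrow> w \<in> W \<Longrightarrow> dist (act k v) (act k w) < e / 2"
    using compact_equicontinuous_at[OF assms(2), of ?K "e / 2" v] \<open>e > 0\<close> by auto
  have "dist (act r x) (act r y) \<le> e"
    if x: "x \<in> W" "act s x \<in> U" and y: "y \<in> W" "act s y \<in> U" for r x y
  proof (cases "r \<in> range (\<lambda>t. t * s)")
    case True
    then obtain t where "r = t * s" by auto
    then have "act r z = act t (act s z)" for z
      using assms(2) by (simp add: dynamical_system_def)
    then show ?thesis using stable_setD[OF assms(5) x(2) y(2)] by simp
  next
    case False
    then have "r \<in> ?K" using closure_subset by fastforce
    then show ?thesis
      using near[of r x] near[of r y] x(1) y(1)
        dist_triangle3[of "act r x" "act r y" "act r v"] by simp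
  qed
  then show thesis
    using W assms(6) dynamical_system_open_preimage[OF assms(2,4), of s]
    by (intro that[of "W \<inter> {x. act s x \<in> U}"]) (auto simp: stable_set_def)
qed

lemma topologically_transitiveD:
  assumes "topologically_transitive act" "open U" "U \<noteq> {}" "open V" "V \<noteq> {}"
  obtains s v where "v \<in> V" "act s v \<in> U"
  using assms unfolding topologically_transitive_def by blast

lemma exists_stable_open_subset:
  fixes act :: "'s::topological_semigroup_mult \<Rightarrow> 'x::metric_space \<Rightarrow> 'x"
  assumes "C_semigroup TYPE('s)" "dynamical_system act" "topologically_transitive act"
    and "\<not> sensitive act" "e > 0" "open V" "V \<noteq> {}"
  obtains U where "open U" "U \<noteq> {}" "U \<subseteq> V" "stable_set act e U"
proof -
  obtain U where U: "open U" "U \<noteq> {}" "stable_set act e U"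
    using exists_stable_open_set_if_not_sensitive[OF assms(4,5)] .
  obtain s v where sv: "v \<in> V" "act s v \<in> U"
    using topologically_transitiveD[OF assms(3) U(1,2) assms(6,7)] .
  obtain W where "open W" "v \<in> W" "stable_set act e W"
    using stable_set_pullback[OF assms(1,2,5) U(1,3) sv(2)] .
  then show thesis
    using sv(1) assms(6) by (intro that[of "V \<inter> W"]) (auto intro: stable_set_subset)
qed

text \<open>Syndetic return: by minimality the preimages of an open set that meets the orbit of an almost
  periodic point cover its compact orbit closure, so finitely many of them do.\<close>

lemma almost_periodic_finite_return:
  assumes "dynamical_system act" "almost_periodic act p" "open B" "act s p \<in> B"
  obtains T where "finite T" "\<And>r. \<exists>t\<in>T. act t (act r p) \<in> B"
proof -
  let ?M = "closure (orbit act p)"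
  have in_M: "act r p \<in> ?M" for r
    by (rule subsetD[OF closure_subset]) (simp add: orbit_def)
  have "\<exists>t. act t m \<in> B" if "m \<in> ?M" for m
  proof -
    have "top_of_set ?M closure_of orbit act m = ?M"
      using assms(2) that unfolding almost_periodic_def minimal_system_def by blast
    then have "?M \<subseteq> closure (orbit act m)"
      using closure_of_subtopology_subset[of euclidean ?M "orbit act m"]
      unfolding euclidean_closure_of by (rule ord_eq_le_trans[OF sym])
    then have "act s p \<in> closure (orbit act m)" using in_M by (rule subsetD)
    then have "B \<inter> orbit act m \<noteq> {}"
      using open_Int_closure_eq_empty[OF assms(3), of "orbit act m"] assms(4) by blast
    then show ?thesis by (auto simp: orbit_def)
  qed
  then have "?M \<subseteq> (\<Union>t. {x. act t x \<in> B})" by blast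
  moreover have "compact ?M" using assms(2) by (simp add: almost_periodic_def)
  ultimately obtain T where "finite T" "?M \<subseteq> (\<Union>t\<in>T. {x. act t x \<in> B})"
    using dynamical_system_open_preimage[OF assms(1,3)] by (metis compactE_image)
  then show thesis using in_M by (intro that[of T]) blast+
qed

lemma minimal_system_UNIV_iff:
  "minimal_system act UNIV \<longleftrightarrow> (\<forall>x. closure (orbit act x) = UNIV)"
  by (simp add: minimal_system_def)

lemma minimal_if_not_sensitive:
  fixes act :: "'s::topological_semigroup_mult \<Rightarrow> 'x::metric_space \<Rightarrow> 'x"
  assumes C: "C_semigroup TYPE('s)" and dyn: "dynamical_system act"
    and M: "M_system act" and ns: "\<not> sensitive act"
  shows "minimal_system act UNIV"
proof -
  have tt: "topologically_transitive act" using M by (simp add: M_system_def)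
  have "\<exists>t. dist (act t y) v < \<epsilon>" if "\<epsilon> > 0" for y v \<epsilon>
  proof -
    \<comment> \<open>The errors are \<open>2 * e\<close> for returning near \<open>v\<close> (the radius of \<open>U\<close> plus its stability), \<open>e\<close> for
      comparing \<open>p\<close> with another point of \<open>U\<close>, and \<open>e\<close> for approximating \<open>y\<close>.\<close>
    define e where "e = \<epsilon> / 4"
    have e: "e > 0" using \<open>\<epsilon> > 0\<close> by (simp add: e_def)
    obtain U where U: "open U" "U \<noteq> {}" "U \<subseteq> ball v e" "stable_set act e U"
      using exists_stable_open_subset[OF C dyn tt ns e, of "ball v e"] e by auto
    obtain p where p: "p \<in> U" "almost_periodic act p"
      using M U(1,2) open_Int_closure_eq_empty[OF U(1), of "{x. almost_periodic act x}"]
      by (auto simp: M_system_def)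
    obtain s u where su: "u \<in> U" "act s u \<in> U"
      using topologically_transitiveD[OF tt U(1,2) U(1,2)] .
    have "dist v (act s u) < e" using su(2) U(3) by auto
    then have "act s p \<in> ball v (2 * e)"
      using stable_setD[OF U(4) su(1) p(1), of s] dist_triangle[of v "act s p" "act s u"] by simp
    then obtain T where T: "finite T" "\<And>r. \<exists>t\<in>T. act t (act r p) \<in> ball v (2 * e)"
      using almost_periodic_finite_return[OF dyn p(2) open_ball] by blast
    let ?N = "\<Inter>t\<in>T. {x. act t x \<in> ball (act t y) e}"
    have "open ?N"
      using T(1) dynamical_system_open_preimage[OF dyn open_ball] by (intro open_INT) auto
    moreover have "y \<in> ?N" using e by simp
    then have "?N \<noteq> {}" by (rule ex_in_conv[THEN iffD1, OF exI])
    ultimately obtain r u' where u': "u' \<in> U" "act r u' \<in> ?N"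
      by (rule topologically_transitiveD[OF tt _ _ U(1,2)])
    obtain t where t: "t \<in> T" "dist v (act t (act r p)) < 2 * e"
      using T(2)[of r] by auto
    have "dist (act t (act r p)) (act t (act r u')) \<le> e"
      using stable_setD[OF U(4) p(1) u'(1), of "t * r"] dyn by (simp add: dynamical_system_def)
    moreover have "dist (act t y) (act t (act r u')) < e" using u'(2) t(1) by auto
    ultimately have "dist (act t y) v < 4 * e"
      using t(2) dist_triangle[of "act t y" v "act t (act r u')"]
        dist_triangle[of "act t (act r u')" v "act t (act r p)"]
        dist_commute[of v "act t (act r p)"]
        dist_commute[of "act t (act r p)" "act t (act r u')"]
      by linarith
    then have "dist (act t y) v < \<epsilon>" by (simp add: e_def)
    then show ?thesis ..
  qed
  then show ?thesis
    by (auto simp: minimal_system_UNIV_iff closure_approachable orbit_def)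
qed

lemma equicontinuous_if_minimal_not_sensitive:
  fixes act :: "'s::topological_semigroup_mult \<Rightarrow> 'x::metric_space \<Rightarrow> 'x"
  assumes C: "C_semigroup TYPE('s)" and dyn: "dynamical_system act"
    and min: "minimal_system act UNIV" and ns: "\<not> sensitive act"
  shows "equicontinuous_system act"
  unfolding equicontinuous_system_def equicontinuity_point_def
proof (intro allI impI)
  fix x and \<epsilon> :: real
  assume "\<epsilon> > 0"
  then have e: "\<epsilon> / 2 > 0" by simp
  obtain U where U: "open U" "U \<noteq> {}" "stable_set act (\<epsilon> / 2) U"
    using exists_stable_open_set_if_not_sensitive[OF ns e] .
  have "orbit act x \<inter> U \<noteq> {}"
    using min U(1,2) open_Int_closure_eq_empty[OF U(1), of "orbit act x"]
    by (auto simp: minimal_system_UNIV_iff)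
  then obtain s where "act s x \<in> U" by (auto simp: orbit_def)
  then obtain W where W: "open W" "x \<in> W" "stable_set act (\<epsilon> / 2) W"
    using stable_set_pullback[OF C dyn e U(1,3)] by blast
  then obtain \<delta> where \<delta>: "\<delta> > 0" "ball x \<delta> \<subseteq> W" by (meson openE)
  have "dist (act s x) (act s y) < \<epsilon>" if "dist x y < \<delta>" for y s
  proof -
    have "y \<in> W" using that \<delta>(2) by auto
    with stable_setD[OF W(3,2), of y s] \<open>\<epsilon> > 0\<close> show ?thesis by simp
  qed
  with \<delta>(1) show "\<exists>\<delta>>0. \<forall>y. dist x y < \<delta> \<longrightarrow> (\<forall>s. dist (act s x) (act s y) < \<epsilon>)"
    by blast
qed

theorem theorem5p7:
  fixes act :: "'s::topological_semigroup_mult \<Rightarrow> 'x::metric_space \<Rightarrow> 'x"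
  assumes "C_semigroup TYPE('s)"
    and "polish_topology (euclidean :: 'x topology)"
    and "dynamical_system act"
    and "M_system act"
    and "\<not> minimal_system act UNIV \<or> \<not> equicontinuous_system act"
  shows "sensitive act"
proof (rule ccontr)
  assume ns: "\<not> sensitive act"
  have "minimal_system act UNIV"
    using minimal_if_not_sensitive[OF assms(1,3,4) ns] .
  moreover from this have "equicontinuous_system act"
    using equicontinuous_if_minimal_not_sensitive[OF assms(1,3) _ ns] by blast
  ultimately show False using assms(5) by blast
qed

end
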